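(* Let $I,J$ be arbitrary sets, let $P\subseteq [0,1]^{I}$ and $Q\subseteq [0,1]^{J}$, and let $\eta\colon P\to Q$ be any map. The following are equivalent: (i) the map $\eta$ is definable; (ii) the map $\eta$ is a $\mathbb{Z}$-map; (iii) for each finite subset $J'\subseteq J$ there exist a finite set $I'\subseteq I$ and a $\mathbb{Z}$-map $\xi\colon [0,1]^{I'}\to [0,1]^{J'}$ such that $\pi^{J}_{J'}\circ\eta=\xi\circ\pi^{I}_{I'}$ (as maps on $P$).
   Context: An MV-algebra is an abelian monoid $(A,\oplus,0)$ with a unary operation $\neg$ such that $\neg\neg x=x$, $x\oplus\neg 0=\neg 0$, and $x\oplus\neg(x\oplus\neg y)=y\oplus\neg(y\oplus\neg x)$. The standard MV-algebra is $[0,1]$ with $x\oplus y=\min\{x+y,1\}$, $\neg x=1-x$ and neutral element $0$. For a set $I$, $\mathscr{F}(I)$ is the free MV-algebra freely generated by $I$. For $p\in[0,1]^I$, $\bar p\colon\mathscr{F}(I)\to[0,1]$ is the unique MV-homomorphism extending $p\colon I\to[0,1]$. For $I'\subseteq I$, $\pi^I_{I'}\colon[0,1]^I\to[0,1]^{I'}$ is the projection. Definable map: for $P\subseteq[0,1]^I$, $Q\subseteq[0,1]^J$, a function $\eta\colon P\to Q$ is definable if there exist elements $t_j\in\mathscr{F}(I)$ ($j\in J$) such that $(\eta(p))(j)=\bar p(t_j)$ for all $p\in P$, $j\in J$. Piecewise linear map with integer coefficients: for a finite set $I'$, a continuous map $f\colon[0,1]^{I'}\to[0,1]$ is piecewise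 linear with integer coefficients if there are finitely many affine linear functions $f_1,\dots,f_k\colon\mathbb{R}^{I'}\to\mathbb{R}$ with integer coefficients (including the constant terms) such that for every $x$ there is some $i$ with $f(x)=f_i(x)$. For an arbitrary set $I$, a map $f\colon[0,1]^I\to[0,1]$ is piecewise linear with integer coefficients if there are a finite $I'\subseteq I$ and a piecewise linear map with integer coefficients $f'\colon[0,1]^{I'}\to[0,1]$ with $f=f'\circ\pi^I_{I'}$. $\mathbb{Z}$-map: for $P\subseteq[0,1]^I$, $Q\subseteq[0,1]^J$, a map $\eta\colon P\to Q$ is a $\mathbb{Z}$-map if for every $j\in J$ there exists a piecewise linear map with integer coefficients $\xi_j\colon[0,1]^I\to[0,1]$ such that $\eta(p)=(\xi_j(p))_{j\in J}$ for all $p\in P$. *)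

theory Defs
  imports "HOL-Analysis.Function_Topology" "HOL-Algebra.Group"
begin

section \<open>MV-algebras\<close>

text \<open>The abelian monoid underlying an MV-algebra is a \<open>comm_monoid\<close> of HOL-Algebra, whose
  notation is multiplicative: \<open>x \<otimes> y\<close> is the MV-algebraic sum of \<open>x\<close> and \<open>y\<close>, and \<open>\<one>\<close> is the
  neutral element, the constant 0 of the MV-algebra.\<close>

record 'a mv_struct = "'a monoid" +
  mv_neg :: "'a \<Rightarrow> 'a"

locale mv_algebra = comm_monoid A for A :: "('a, 'm) mv_struct_scheme" (structure) +
  assumes neg_closed [intro, simp]: "x \<in> carrier A \<Longrightarrow> mv_neg A x \<in> carrier A"
    and neg_neg: "x \<in> carrier A \<Longrightarrow> mv_neg A (mv_neg A x) = x"
    and neg_zero_absorb: "x \<in> carrier A \<Longrightarrow> x \<otimes> mv_neg A \<one> = mv_neg A \<one>"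
    and lukasiewicz: "\<lbrakk>x \<in> carrier A; y \<in> carrier A\<rbrakk> \<Longrightarrow>
      x \<otimes> mv_neg A (x \<otimes> mv_neg A y) = y \<otimes> mv_neg A (y \<otimes> mv_neg A x)"

definition mv_hom ::
    "('a, 'm) mv_struct_scheme \<Rightarrow> ('b, 'n) mv_struct_scheme \<Rightarrow> ('a \<Rightarrow> 'b) set" where
  "mv_hom A B = {h \<in> hom A B. h \<one>\<^bsub>A\<^esub> = \<one>\<^bsub>B\<^esub> \<and>
      (\<forall>x\<in>carrier A. h (mv_neg A x) = mv_neg B (h x))}"

definition std_mv :: "real mv_struct" where
  "std_mv = \<lparr>carrier = {0..1}, mult = (\<lambda>x y. min (x + y) 1), one = 0, mv_neg = (\<lambda>x. 1 - x)\<rparr>"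

lemma std_mv_simps [simp]:
  "carrier std_mv = {0..1}" "x \<otimes>\<^bsub>std_mv\<^esub> y = min (x + y) 1"
  "\<one>\<^bsub>std_mv\<^esub> = 0" "mv_neg std_mv x = 1 - x"
  by (simp_all add: std_mv_def)

lemma mv_algebra_std_mv: "mv_algebra std_mv"
  by unfold_locales (auto simp: min_def)


section \<open>Free MV-algebras\<close>

datatype 'i mv_term =
    Var 'i
  | Zero
  | Plus "'i mv_term" "'i mv_term"
  | Neg "'i mv_term"

definition mv_terms :: "'i set \<Rightarrow> 'i mv_term set" where
  "mv_terms I = {t. set_mv_term t \<subseteq> I}"

lemma mv_terms_simps [simp]:
  "Var i \<in> mv_terms I \<longleftrightarrow> i \<in> I" "Zero \<in> mv_terms I"
  "Plus s t \<in> mv_terms I \<longleftrightarrow> s \<in> mv_terms I \<and> t \<in> mv_terms I"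
  "Neg s \<in> mv_terms I \<longleftrightarrow> s \<in> mv_terms I"
  by (auto simp: mv_terms_def)

text \<open>The congruence on the terms over \<open>I\<close> generated by the MV-algebra identities; the free
  MV-algebra over \<open>I\<close> is the quotient.\<close>

inductive_set mv_eq :: "'i set \<Rightarrow> ('i mv_term \<times> 'i mv_term) set" for I :: "'i set" where
  refl: "s \<in> mv_terms I \<Longrightarrow> (s, s) \<in> mv_eq I"
| sym: "(s, t) \<in> mv_eq I \<Longrightarrow> (t, s) \<in> mv_eq I"
| trans: "\<lbrakk>(s, t) \<in> mv_eq I; (t, u) \<in> mv_eq I\<rbrakk> \<Longrightarrow> (s, u) \<in> mv_eq I"
| cong_Plus: "\<lbrakk>(s, s') \<in> mv_eq I; (t, t') \<in> mv_eq I\<rbrakk> \<Longrightarrow> (Plus s t, Plus s' t') \<in> mv_eq I"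
| cong_Neg: "(s, s') \<in> mv_eq I \<Longrightarrow> (Neg s, Neg s') \<in> mv_eq I"
| assoc: "\<lbrakk>s \<in> mv_terms I; t \<in> mv_terms I; u \<in> mv_terms I\<rbrakk> \<Longrightarrow>
    (Plus (Plus s t) u, Plus s (Plus t u)) \<in> mv_eq I"
| comm: "\<lbrakk>s \<in> mv_terms I; t \<in> mv_terms I\<rbrakk> \<Longrightarrow> (Plus s t, Plus t s) \<in> mv_eq I"
| unit: "s \<in> mv_terms I \<Longrightarrow> (Plus s Zero, s) \<in> mv_eq I"
| neg_neg: "s \<in> mv_terms I \<Longrightarrow> (Neg (Neg s), s) \<in> mv_eq I"
| neg_zero_absorb: "s \<in> mv_terms I \<Longrightarrow> (Plus s (Neg Zero), Neg Zero) \<in> mv_eq I"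
| lukasiewicz: "\<lbrakk>s \<in> mv_terms I; t \<in> mv_terms I\<rbrakk> \<Longrightarrow>
    (Plus s (Neg (Plus s (Neg t))), Plus t (Neg (Plus t (Neg s)))) \<in> mv_eq I"

definition free_mv :: "'i set \<Rightarrow> 'i mv_term set mv_struct" where
  "free_mv I = \<lparr>carrier = mv_terms I // mv_eq I,
     mult = (\<lambda>X Y. \<Union>s\<in>X. \<Union>t\<in>Y. mv_eq I `` {Plus s t}),
     one = mv_eq I `` {Zero},
     mv_neg = (\<lambda>X. \<Union>s\<in>X. mv_eq I `` {Neg s})\<rparr>"

definition free_gen :: "'i set \<Rightarrow> 'i \<Rightarrow> 'i mv_term set" where
  "free_gen I i = mv_eq I `` {Var i}"

lemma mv_eq_terms:
  assumes "(s, t) \<in> mv_eq I"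
  shows "s \<in> mv_terms I \<and> t \<in> mv_terms I"
  using assms by induction auto

lemma equiv_mv_eq: "equiv (mv_terms I) (mv_eq I)"
proof (intro equivI refl_onI symI transI)
  show "mv_eq I \<subseteq> mv_terms I \<times> mv_terms I" by (auto dest: mv_eq_terms)
qed (fact mv_eq.refl mv_eq.sym mv_eq.trans)+

lemma mv_class_eq: "(s, t) \<in> mv_eq I \<Longrightarrow> mv_eq I `` {s} = mv_eq I `` {t}"
  using equiv_mv_eq by (rule equiv_class_eq)

lemma free_mv_class [simp]: "s \<in> mv_terms I \<Longrightarrow> mv_eq I `` {s} \<in> carrier (free_mv I)"
  by (simp add: free_mv_def quotientI)

lemma free_mv_cases:
  assumes "X \<in> carrier (free_mv I)"
  obtains s where "s \<in> mv_terms I" "X = mv_eq I `` {s}"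
  using assms by (auto simp: free_mv_def elim: quotientE)

lemma free_mv_one: "\<one>\<^bsub>free_mv I\<^esub> = mv_eq I `` {Zero}"
  by (simp add: free_mv_def)

lemma free_mv_neg:
  assumes "s \<in> mv_terms I"
  shows "mv_neg (free_mv I) (mv_eq I `` {s}) = mv_eq I `` {Neg s}"
proof -
  have "mv_eq I `` {Neg s'} = mv_eq I `` {Neg s}" if "s' \<in> mv_eq I `` {s}" for s'
    using that by (auto intro!: mv_class_eq[OF mv_eq.sym[OF mv_eq.cong_Neg]])
  moreover have "s \<in> mv_eq I `` {s}"
    using assms by (auto intro: mv_eq.refl)
  ultimately have "(\<Union>s'\<in>mv_eq I `` {s}. mv_eq I `` {Neg s'}) = mv_eq I `` {Neg s}"
    by blast
  then show ?thesis
    by (simp add: free_mv_def)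
qed

lemma free_mv_mult:
  assumes "s \<in> mv_terms I" "t \<in> mv_terms I"
  shows "mv_eq I `` {s} \<otimes>\<^bsub>free_mv I\<^esub> mv_eq I `` {t} = mv_eq I `` {Plus s t}"
proof -
  have "mv_eq I `` {Plus s' t'} = mv_eq I `` {Plus s t}"
    if "s' \<in> mv_eq I `` {s}" "t' \<in> mv_eq I `` {t}" for s' t'
    using that by (auto intro!: mv_class_eq[OF mv_eq.sym[OF mv_eq.cong_Plus]])
  moreover have "s \<in> mv_eq I `` {s}" "t \<in> mv_eq I `` {t}"
    using assms by (auto intro: mv_eq.refl)
  ultimately have "(\<Union>s'\<in>mv_eq I `` {s}. \<Union>t'\<in>mv_eq I `` {t}. mv_eq I `` {Plus s' t'})
      = mv_eq I `` {Plus s t}"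
    by blast
  then show ?thesis
    by (simp add: free_mv_def)
qed

lemmas free_mv_ops = free_mv_one free_mv_neg free_mv_mult

lemma mv_algebra_free_mv: "mv_algebra (free_mv I)"
proof (unfold_locales, goal_cases)
  case (1 x y)
  then show ?case by (auto elim!: free_mv_cases simp: free_mv_ops)
next
  case (2 x y z)
  then show ?case
    by (auto elim!: free_mv_cases simp: free_mv_ops mv_class_eq[OF mv_eq.assoc])
next
  case 3
  then show ?case by (simp add: free_mv_ops)
next
  case (4 x)
  then obtain s where s: "s \<in> mv_terms I" "x = mv_eq I `` {s}" by (rule free_mv_cases)
  then have "(Plus Zero s, s) \<in> mv_eq I"
    by (meson mv_eq.comm mv_eq.trans mv_eq.unit mv_terms_simps(2))
  with s show ?case by (simp add: free_mv_ops mv_class_eq)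
next
  case (5 x)
  then show ?case
    by (auto elim!: free_mv_cases simp: free_mv_ops mv_class_eq[OF mv_eq.unit])
next
  case (6 x y)
  then show ?case
    by (auto elim!: free_mv_cases simp: free_mv_ops mv_class_eq[OF mv_eq.comm])
next
  case (7 x)
  then show ?case by (auto elim!: free_mv_cases simp: free_mv_ops)
next
  case (8 x)
  then show ?case
    by (auto elim!: free_mv_cases simp: free_mv_ops mv_class_eq[OF mv_eq.neg_neg])
next
  case (9 x)
  then show ?case
    by (auto elim!: free_mv_cases simp: free_mv_ops mv_class_eq[OF mv_eq.neg_zero_absorb])
next
  case (10 x y)
  then show ?case
    by (auto elim!: free_mv_cases simp: free_mv_ops mv_class_eq[OF mv_eq.lukasiewicz])
qed

primrec mv_eval :: "('b, 'm) mv_struct_scheme \<Rightarrow> ('i \<Rightarrow> 'b) \<Rightarrow> 'i mv_term \<Rightarrow> 'b" where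
  "mv_eval A p (Var i) = p i"
| "mv_eval A p Zero = \<one>\<^bsub>A\<^esub>"
| "mv_eval A p (Plus s t) = mv_eval A p s \<otimes>\<^bsub>A\<^esub> mv_eval A p t"
| "mv_eval A p (Neg s) = mv_neg A (mv_eval A p s)"

lemma mv_eval_closed:
  assumes "mv_algebra A" "p \<in> I \<rightarrow> carrier A" "t \<in> mv_terms I"
  shows "mv_eval A p t \<in> carrier A"
proof -
  interpret mv_algebra A by fact
  show ?thesis using assms(2,3) by (induction t) auto
qed

lemma mv_eval_cong:
  assumes "mv_algebra A" "p \<in> I \<rightarrow> carrier A" "(s, t) \<in> mv_eq I"
  shows "mv_eval A p s = mv_eval A p t"
proof -
  interpret mv_algebra A by fact
  note closed = mv_eval_closed[OF assms(1,2)]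
  show ?thesis using assms(3)
  proof induction
    case (comm s t)
    then show ?case by (simp add: closed m_comm)
  next
    case (lukasiewicz s t)
    then show ?case by (simp only: mv_eval.simps closed mv_algebra.lukasiewicz[OF assms(1)])
  qed (simp_all add: closed m_assoc neg_neg neg_zero_absorb)
qed

lemma mv_hom_eq_mv_eval:
  assumes "h \<in> mv_hom (free_mv I) A" "\<And>i. i \<in> I \<Longrightarrow> h (free_gen I i) = p i" "t \<in> mv_terms I"
  shows "h (mv_eq I `` {t}) = mv_eval A p t"
  using assms(3)
proof (induction t)
  case (Var i)
  then show ?case using assms(2) by (simp add: free_gen_def)
next
  case Zero
  then show ?case using assms(1) by (simp add: mv_hom_def free_mv_one)
next
  case (Plus s t)
  then have "h (mv_eq I `` {s} \<otimes>\<^bsub>free_mv I\<^esub> mv_eq I `` {t}) = mv_eval A p (Plus s t)"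
    using assms(1) by (simp add: mv_hom_def hom_def)
  with Plus show ?case by (simp add: free_mv_mult)
next
  case (Neg s)
  then have "h (mv_neg (free_mv I) (mv_eq I `` {s})) = mv_eval A p (Neg s)"
    using assms(1) by (simp add: mv_hom_def)
  with Neg show ?case by (simp add: free_mv_neg)
qed

lemma free_mv_universal:
  assumes A: "mv_algebra A" and p: "p \<in> I \<rightarrow> carrier A"
  shows "\<exists>!h. h \<in> mv_hom (free_mv I) A \<inter> extensional (carrier (free_mv I)) \<and>
           (\<forall>i\<in>I. h (free_gen I i) = p i)"
proof (rule ex_ex1I)
  define h where "h = (\<lambda>X\<in>carrier (free_mv I). mv_eval A p (SOME s. s \<in> X))"
  have h: "h (mv_eq I `` {s}) = mv_eval A p s" if s: "s \<in> mv_terms I" for s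
  proof -
    have "s \<in> mv_eq I `` {s}"
      using s by (simp add: mv_eq.refl)
    then have "(SOME t. t \<in> mv_eq I `` {s}) \<in> mv_eq I `` {s}"
      by (rule someI)
    then have "(s, SOME t. t \<in> mv_eq I `` {s}) \<in> mv_eq I" by simp
    then have "mv_eval A p s = mv_eval A p (SOME t. t \<in> mv_eq I `` {s})"
      by (rule mv_eval_cong[OF A p])
    then show ?thesis using s by (simp add: h_def)
  qed
  have "h X \<in> carrier A" if "X \<in> carrier (free_mv I)" for X
    using that by (rule free_mv_cases) (simp add: h mv_eval_closed[OF A p])
  moreover have "h (X \<otimes>\<^bsub>free_mv I\<^esub> Y) = h X \<otimes>\<^bsub>A\<^esub> h Y"
    if X: "X \<in> carrier (free_mv I)" and Y: "Y \<in> carrier (free_mv I)" for X Y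
    using X
  proof (rule free_mv_cases)
    fix s assume s: "s \<in> mv_terms I" "X = mv_eq I `` {s}"
    show ?thesis using Y by (rule free_mv_cases) (simp add: s free_mv_mult h)
  qed
  moreover have "h (mv_neg (free_mv I) X) = mv_neg A (h X)" if "X \<in> carrier (free_mv I)" for X
    using that by (rule free_mv_cases) (simp add: free_mv_neg h)
  moreover have "h \<one>\<^bsub>free_mv I\<^esub> = \<one>\<^bsub>A\<^esub>"
    by (simp add: free_mv_one h)
  ultimately have "h \<in> mv_hom (free_mv I) A"
    by (simp add: mv_hom_def hom_def)
  moreover have "h \<in> extensional (carrier (free_mv I))"
    by (simp add: h_def)
  moreover have "\<forall>i\<in>I. h (free_gen I i) = p i"
    by (simp add: free_gen_def h)
  ultimately show "\<exists>h. h \<in> mv_hom (free_mv I) A \<inter> extensional (carrier (free_mv I)) \<and>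
      (\<forall>i\<in>I. h (free_gen I i) = p i)"
    by blast
next
  fix g h
  assume g: "g \<in> mv_hom (free_mv I) A \<inter> extensional (carrier (free_mv I)) \<and>
      (\<forall>i\<in>I. g (free_gen I i) = p i)"
    and h: "h \<in> mv_hom (free_mv I) A \<inter> extensional (carrier (free_mv I)) \<and>
      (\<forall>i\<in>I. h (free_gen I i) = p i)"
  show "g = h"
  proof (rule extensionalityI[of _ "carrier (free_mv I)"])
    fix X assume "X \<in> carrier (free_mv I)"
    then obtain s where "s \<in> mv_terms I" "X = mv_eq I `` {s}" by (rule free_mv_cases)
    then show "g X = h X"
      using mv_hom_eq_mv_eval[of g I A p s] mv_hom_eq_mv_eval[of h I A p s] g h by auto
  qed (use g h in auto)
qed

text \<open>The homomorphism from the free MV-algebra over \<open>I\<close> to the standard MV-algebra extending a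
  point \<open>p\<close> of the cube; it exists and is unique by \<open>free_mv_universal\<close>.\<close>

definition mv_bar :: "'i set \<Rightarrow> ('i \<Rightarrow> real) \<Rightarrow> 'i mv_term set \<Rightarrow> real" where
  "mv_bar I p = (THE h. h \<in> mv_hom (free_mv I) std_mv \<inter> extensional (carrier (free_mv I)) \<and>
      (\<forall>i\<in>I. h (free_gen I i) = p i))"


section \<open>Maps between subsets of cubes\<close>

text \<open>Points of the cube over \<open>I\<close> are functions that are \<open>undefined\<close> outside \<open>I\<close>, so the
  projection to a subset \<open>I'\<close> of coordinates is \<open>\<lambda>p. restrict p I'\<close>.\<close>

definition cube :: "'i set \<Rightarrow> ('i \<Rightarrow> real) set" where
  "cube I = I \<rightarrow>\<^sub>E {0..1}"

definition definable_map ::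
    "'i set \<Rightarrow> 'j set \<Rightarrow> ('i \<Rightarrow> real) set \<Rightarrow> ('j \<Rightarrow> real) set \<Rightarrow> (('i \<Rightarrow> real) \<Rightarrow> ('j \<Rightarrow> real)) \<Rightarrow> bool"
  where
  "definable_map I J P Q \<eta> \<longleftrightarrow> P \<subseteq> cube I \<and> Q \<subseteq> cube J \<and> \<eta> \<in> P \<rightarrow> Q \<and>
     (\<exists>t \<in> J \<rightarrow> carrier (free_mv I). \<forall>p\<in>P. \<forall>j\<in>J. \<eta> p j = mv_bar I p (t j))"

definition int_affine :: "'i set \<Rightarrow> (('i \<Rightarrow> real) \<Rightarrow> real) \<Rightarrow> bool" where
  "int_affine I g \<longleftrightarrow> (\<exists>(c :: 'i \<Rightarrow> int) (d :: int). \<forall>x \<in> I \<rightarrow>\<^sub>E UNIV.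
     g x = (\<Sum>i\<in>I. of_int (c i) * x i) + of_int d)"

definition finite_pl_int :: "'i set \<Rightarrow> (('i \<Rightarrow> real) \<Rightarrow> real) \<Rightarrow> bool" where
  "finite_pl_int I f \<longleftrightarrow> finite I \<and>
     continuous_map (product_topology (\<lambda>_. top_of_set {0..1}) I) (top_of_set {0..1}) f \<and>
     (\<exists>F. finite F \<and> (\<forall>g\<in>F. int_affine I g) \<and> (\<forall>x\<in>cube I. \<exists>g\<in>F. f x = g x))"

definition pl_int :: "'i set \<Rightarrow> (('i \<Rightarrow> real) \<Rightarrow> real) \<Rightarrow> bool" where
  "pl_int I f \<longleftrightarrow> (\<exists>I' f'. finite I' \<and> I' \<subseteq> I \<and> finite_pl_int I' f' \<and>
     (\<forall>x\<in>cube I. f x = f' (restrict x I')))"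

definition Z_map ::
    "'i set \<Rightarrow> 'j set \<Rightarrow> ('i \<Rightarrow> real) set \<Rightarrow> ('j \<Rightarrow> real) set \<Rightarrow> (('i \<Rightarrow> real) \<Rightarrow> ('j \<Rightarrow> real)) \<Rightarrow> bool"
  where
  "Z_map I J P Q \<eta> \<longleftrightarrow> P \<subseteq> cube I \<and> Q \<subseteq> cube J \<and> \<eta> \<in> P \<rightarrow> Q \<and>
     (\<forall>j\<in>J. \<exists>\<xi>. pl_int I \<xi> \<and> (\<forall>p\<in>P. \<eta> p j = \<xi> p))"

end

theory Submission
  imports Defs
begin

text \<open>The heart of the matter is McNaughton's theorem: a continuous piecewise linear function with
  integer coefficients on a finite-dimensional cube is the evaluation of a term. If \<open>f\<close> has pieces
  in a finite set \<open>F\<close>, then restricting to segments shows that for any two points \<open>a\<close>, \<open>b\<close> some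
  piece lies above \<open>f\<close> at \<open>a\<close> and below \<open>f\<close> at \<open>b\<close>. Hence \<open>f\<close> is the maximum over \<open>a\<close> of the
  minima of the pieces that lie above \<open>f\<close> at \<open>a\<close>, and only finitely many sets of pieces occur.
  As \<open>f\<close> has values in the unit interval, the pieces may be truncated to it, and a truncated
  integer affine function is built up from terms by induction on its coefficients.\<close>

section \<open>Evaluation in the standard MV-algebra\<close>

text \<open>The universal property makes the description in \<open>mv_bar\<close> denote a
  homomorphism extending \<open>p\<close>, and any such homomorphism acts on classes by
  evaluation.\<close>

lemma mv_bar_eq_mv_eval:
  assumes "p \<in> cube I" "t \<in> mv_terms I"
  shows "mv_bar I p (mv_eq I `` {t}) = mv_eval std_mv p t"
proof -
  have "p \<in> I \<rightarrow> carrier std_mv"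
    using assms(1) by (auto simp: cube_def)
  from theI'[OF free_mv_universal[OF mv_algebra_std_mv this]]
  show ?thesis
    using assms(2) by (intro mv_hom_eq_mv_eval) (auto simp: mv_bar_def)
qed

lemma mv_eval_range:
  assumes "p \<in> cube I" "t \<in> mv_terms I"
  shows "mv_eval std_mv p t \<in> {0..1}"
  using mv_eval_closed[OF mv_algebra_std_mv, of p I t] assms by (auto simp: cube_def)

lemma mv_eval_restrict:
  "t \<in> mv_terms I \<Longrightarrow> mv_eval A (restrict p I) t = mv_eval A p t"
  by (induction t) auto

lemma mv_terms_mono: "I' \<subseteq> I \<Longrightarrow> t \<in> mv_terms I' \<Longrightarrow> t \<in> mv_terms I"
  by (auto simp: mv_terms_def)

lemma restrict_cube: "p \<in> cube I \<Longrightarrow> I' \<subseteq> I \<Longrightarrow> restrict p I' \<in> cube I'"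
  by (auto simp: cube_def)

text \<open>The bounds come from the codomain topology in the continuity clause; the affine pieces
  themselves may leave the unit interval.\<close>

lemma finite_pl_int_range:
  assumes "finite_pl_int I f" "x \<in> cube I"
  shows "f x \<in> {0..1}"
proof -
  have "f \<in> topspace (product_topology (\<lambda>_. top_of_set {0..1}) I) \<rightarrow> topspace (top_of_set {0..1})"
    by (rule continuous_map_funspace) (use assms(1) in \<open>simp add: finite_pl_int_def\<close>)
  with assms(2) show ?thesis
    by (simp add: cube_def Pi_iff)
qed

section \<open>Closure properties of integer affine functions\<close>

lemma int_affine_const: "int_affine I (\<lambda>x. of_int d)"
  unfolding int_affine_def by (intro exI[of _ "\<lambda>_. 0"] exI[of _ d]) simp

lemma int_affine_add:
  assumes "int_affine I f" "int_affine I g"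
  shows "int_affine I (\<lambda>x. f x + g x)"
proof -
  obtain c d c' d' where "\<forall>x\<in>I \<rightarrow>\<^sub>E UNIV. f x = (\<Sum>i\<in>I. of_int (c i) * x i) + of_int d"
    "\<forall>x\<in>I \<rightarrow>\<^sub>E UNIV. g x = (\<Sum>i\<in>I. of_int (c' i) * x i) + of_int d'"
    using assms unfolding int_affine_def by blast
  then show ?thesis
    unfolding int_affine_def
    by (intro exI[of _ "\<lambda>i. c i + c' i"] exI[of _ "d + d'"])
       (simp add: sum.distrib algebra_simps)
qed

lemma int_affine_uminus:
  assumes "int_affine I f"
  shows "int_affine I (\<lambda>x. - f x)"
proof -
  obtain c d where "\<forall>x\<in>I \<rightarrow>\<^sub>E UNIV. f x = (\<Sum>i\<in>I. of_int (c i) * x i) + of_int d"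
    using assms unfolding int_affine_def by blast
  then show ?thesis
    unfolding int_affine_def
    by (intro exI[of _ "\<lambda>i. - c i"] exI[of _ "- d"]) (simp add: sum_negf)
qed

lemma int_affine_coordinate:
  assumes "finite I" "i \<in> I"
  shows "int_affine I (\<lambda>x. x i)"
proof -
  have "(\<Sum>k\<in>I. of_int (if k = i then 1 else 0) * x k) = x i" for x :: "'a \<Rightarrow> real"
  proof -
    have "(\<Sum>k\<in>I. of_int (if k = i then 1 else 0) * x k) = (\<Sum>k\<in>I. if k = i then x k else 0)"
      by (intro sum.cong) auto
    also have "\<dots> = x i" using assms by simp
    finally show ?thesis .
  qed
  then show ?thesis
    unfolding int_affine_def
    by (intro exI[of _ "\<lambda>k. if k = i then 1 else 0"] exI[of _ 0]) simp
qed

text \<open>The easy converse of McNaughton's theorem: continuity and finitely many pieces are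
  obtained by separate inductions on the term.\<close>

lemma finite_pl_int_mv_eval:
  assumes "finite I" "t \<in> mv_terms I"
  shows "finite_pl_int I (\<lambda>x. mv_eval std_mv x t)"
proof -
  let ?X = "product_topology (\<lambda>_. top_of_set {0..1::real}) I"
  \<comment> \<open>The whole real line as codomain makes the rules for sums and minima applicable;
    the range of evaluation then gives the unit interval back.\<close>
  have "continuous_map ?X euclideanreal (\<lambda>x. mv_eval std_mv x t)"
    using assms(2)
  proof (induction t)
    case (Var i)
    then show ?case
      using continuous_map_into_fulltopology[OF continuous_map_product_projection[of i I]]
      by simp
  next
    case (Plus s t)
    then show ?case by (auto intro!: continuous_map_real_min continuous_map_add)
  next
    case (Neg t)
    then show ?case by (auto intro!: continuous_map_diff)
  qed auto
  then have cont: "continuous_map ?X (top_of_set {0..1}) (\<lambda>x. mv_eval std_mv x t)"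
    using mv_eval_range[OF _ assms(2)]
    by (simp add: continuous_map_in_subtopology Pi_iff cube_def)
  have "\<exists>F. finite F \<and> (\<forall>g\<in>F. int_affine I g) \<and> (\<forall>x\<in>cube I. \<exists>g\<in>F. mv_eval std_mv x t = g x)"
    using assms(2)
  proof (induction t)
    case (Var i)
    then show ?case
      using int_affine_coordinate[OF assms(1)] by (intro exI[of _ "{\<lambda>x. x i}"]) simp
  next
    case Zero
    then show ?case
      using int_affine_const[of I 0] by (intro exI[of _ "{\<lambda>x. 0}"]) simp
  next
    case (Plus s t)
    then obtain F G where F: "finite F" "\<forall>g\<in>F. int_affine I g"
        "\<forall>x\<in>cube I. \<exists>g\<in>F. mv_eval std_mv x s = g x"
      and G: "finite G" "\<forall>g\<in>G. int_affine I g"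
        "\<forall>x\<in>cube I. \<exists>g\<in>G. mv_eval std_mv x t = g x"
      by auto
    \<comment> \<open>A truncated sum is a sum of active pieces where this is at most 1, and the
      constant 1 elsewhere.\<close>
    have "\<exists>h\<in>insert (\<lambda>x. 1) ((\<lambda>(f, g) x. f x + g x) ` (F \<times> G)). mv_eval std_mv x (Plus s t) = h x"
      if x: "x \<in> cube I" for x
    proof -
      obtain f g where "f \<in> F" "g \<in> G" "mv_eval std_mv x s = f x" "mv_eval std_mv x t = g x"
        using F(3) G(3) x by blast
      then show ?thesis
        by (cases "f x + g x \<le> 1") (force simp: min_def)+
    qed
    then show ?case
      using F(1,2) G(1,2) int_affine_const[of I 1]
      by (intro exI[of _ "insert (\<lambda>x. 1) ((\<lambda>(f, g) x. f x + g x) ` (F \<times> G))"])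
         (auto intro: int_affine_add)
  next
    case (Neg t)
    then obtain F where F: "finite F" "\<forall>g\<in>F. int_affine I g"
        "\<forall>x\<in>cube I. \<exists>g\<in>F. mv_eval std_mv x t = g x"
      by auto
    have "int_affine I (\<lambda>x. 1 - f x)" if "f \<in> F" for f
      using int_affine_add[OF int_affine_const[of I 1] int_affine_uminus[of I f]] F(2) that by simp
    with F show ?case
      by (intro exI[of _ "(\<lambda>f x. 1 - f x) ` F"]) fastforce
  qed
  with cont assms(1) show ?thesis
    by (simp add: finite_pl_int_def)
qed

section \<open>Functions given by terms\<close>

text \<open>Speaking of functions up to equality on the cube turns closure under connectives into
  real arithmetic.\<close>

definition term_function :: "'i set \<Rightarrow> (('i \<Rightarrow> real) \<Rightarrow> real) \<Rightarrow> bool" where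
  "term_function I f \<longleftrightarrow> (\<exists>t\<in>mv_terms I. \<forall>x\<in>cube I. mv_eval std_mv x t = f x)"

lemma term_function_cong:
  "term_function I f \<Longrightarrow> (\<And>x. x \<in> cube I \<Longrightarrow> f x = g x) \<Longrightarrow> term_function I g"
  by (auto simp: term_function_def)

lemma term_function_range: "term_function I f \<Longrightarrow> x \<in> cube I \<Longrightarrow> f x \<in> {0..1}"
  unfolding term_function_def using mv_eval_range by metis

lemma term_function_0: "term_function I (\<lambda>x. 0)"
  unfolding term_function_def by (intro bexI[of _ Zero]) auto

lemma term_function_coordinate: "i \<in> I \<Longrightarrow> term_function I (\<lambda>x. x i)"
  unfolding term_function_def by (intro bexI[of _ "Var i"]) auto

lemma term_function_neg: "term_function I f \<Longrightarrow> term_function I (\<lambda>x. 1 - f x)"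
  unfolding term_function_def by (metis mv_eval.simps(4) mv_terms_simps(4) std_mv_simps(4))

lemma term_function_oplus:
  assumes "term_function I f" "term_function I g"
  shows "term_function I (\<lambda>x. min (f x + g x) 1)"
  using assms unfolding term_function_def
  by (metis mv_eval.simps(3) mv_terms_simps(3) std_mv_simps(2))

text \<open>The Lukasiewicz conjunction, obtained as the De Morgan dual of the truncated
  sum.\<close>

lemma term_function_odot:
  assumes "term_function I f" "term_function I g"
  shows "term_function I (\<lambda>x. max (f x + g x - 1) 0)"
  using term_function_neg[OF term_function_oplus[OF assms[THEN term_function_neg]]]
  by (rule term_function_cong) (auto simp: min_def max_def)

text \<open>Adding \<open>g\<close> to the truncated difference \<open>max (f - g) 0\<close> gives
  the maximum; that difference is the conjunction of \<open>f\<close> with the negation of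
  \<open>g\<close>.\<close>

lemma term_function_max:
  assumes f: "term_function I f" and g: "term_function I g"
  shows "term_function I (\<lambda>x. max (f x) (g x))"
  using term_function_oplus[OF term_function_odot[OF f term_function_neg[OF g]] g]
proof (rule term_function_cong)
  fix x assume "x \<in> cube I"
  then show "min (max (f x + (1 - g x) - 1) 0 + g x) 1 = max (f x) (g x)"
    using term_function_range[OF f] term_function_range[OF g] by (fastforce simp: min_def max_def)
qed

lemma term_function_min:
  assumes "term_function I f" "term_function I g"
  shows "term_function I (\<lambda>x. min (f x) (g x))"
  using term_function_neg[OF term_function_max[OF assms[THEN term_function_neg]]]
  by (rule term_function_cong) (auto simp: min_def max_def)

text \<open>The inserted 0, the least possible value of a term function on the cube, serves as the
  maximum of the empty family.\<close>

lemma term_function_Max: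
  assumes "finite S" "\<And>s. s \<in> S \<Longrightarrow> term_function I (h s)"
  shows "term_function I (\<lambda>x. Max (insert 0 ((\<lambda>s. h s x) ` S)))"
  using assms
proof (induction S)
  case (insert s S)
  then have "term_function I (\<lambda>x. max (h s x) (Max (insert 0 ((\<lambda>s. h s x) ` S))))"
    by (intro term_function_max) auto
  moreover have "Max (insert 0 ((\<lambda>s. h s x) ` insert s S)) =
      max (h s x) (Max (insert 0 ((\<lambda>s. h s x) ` S)))" for x
  proof -
    \<comment> \<open>Swapping the two insertions lets \<open>Max_insert\<close> split off
      \<open>h s x\<close> instead of 0.\<close>
    have "insert 0 ((\<lambda>s. h s x) ` insert s S) = insert (h s x) (insert 0 ((\<lambda>s. h s x) ` S))"
      by auto
    from arg_cong[OF this, of Max] show ?thesis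
      using insert.hyps by (subst (asm) Max_insert) auto
  qed
  ultimately show ?case by (simp only:)
qed (simp add: term_function_0)

lemma term_function_Min:
  assumes "finite S" "\<And>s. s \<in> S \<Longrightarrow> term_function I (h s)"
  shows "term_function I (\<lambda>x. Min (insert 1 ((\<lambda>s. h s x) ` S)))"
  using assms
proof (induction S)
  case empty
  then show ?case using term_function_neg[OF term_function_0] by simp
next
  case (insert s S)
  then have "term_function I (\<lambda>x. min (h s x) (Min (insert 1 ((\<lambda>s. h s x) ` S))))"
    by (intro term_function_min) auto
  moreover have "Min (insert 1 ((\<lambda>s. h s x) ` insert s S)) =
      min (h s x) (Min (insert 1 ((\<lambda>s. h s x) ` S)))" for x
  proof -
    have "insert 1 ((\<lambda>s. h s x) ` insert s S) = insert (h s x) (insert 1 ((\<lambda>s. h s x) ` S))"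
      by auto
    from arg_cong[OF this, of Min] show ?thesis
      using insert.hyps by (subst (asm) Min_insert) auto
  qed
  ultimately show ?case by (simp only:)
qed

section \<open>Truncated integer affine functions\<close>

definition trunc_unit :: "real \<Rightarrow> real" where
  "trunc_unit r = max 0 (min 1 r)"

lemma trunc_unit_id: "r \<in> {0..1} \<Longrightarrow> trunc_unit r = r"
  and trunc_unit_mono: "r \<le> s \<Longrightarrow> trunc_unit r \<le> trunc_unit s"
  by (auto simp: trunc_unit_def)

text \<open>All integer translates of \<open>g\<close> are treated simultaneously, because adding a coordinate to
  \<open>g\<close> uses the truncations of both \<open>g\<close> and \<open>g + 1\<close>.\<close>

definition trunc_definable :: "'i set \<Rightarrow> (('i \<Rightarrow> real) \<Rightarrow> real) \<Rightarrow> bool" where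
  "trunc_definable I g \<longleftrightarrow> (\<forall>d::int. term_function I (\<lambda>x. trunc_unit (g x + of_int d)))"

lemma trunc_definable_0: "trunc_definable I (\<lambda>x. 0)"
  unfolding trunc_definable_def
proof
  fix d :: int
  \<comment> \<open>No integer lies strictly between 0 and 1, so the truncation is constantly 0 or
    constantly 1.\<close>
  consider "d \<le> 0" | "d \<ge> 1" by linarith
  then show "term_function I (\<lambda>x. trunc_unit (0 + of_int d))"
  proof cases
    case 1
    then show ?thesis using term_function_0 by (simp add: trunc_unit_def)
  next
    case 2
    then show ?thesis
      using term_function_neg[OF term_function_0] by (simp add: trunc_unit_def)
  qed
qed

lemma trunc_definable_uminus:
  assumes "trunc_definable I g"
  shows "trunc_definable I (\<lambda>x. - g x)"
  unfolding trunc_definable_def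
proof
  fix d :: int
  \<comment> \<open>Truncation commutes with the reflection \<open>s \<mapsto> 1 - s\<close>; taking
    \<open>s = g x + (1 - d)\<close> yields \<open>- g x + d\<close>.\<close>
  have "term_function I (\<lambda>x. 1 - trunc_unit (g x + of_int (1 - d)))"
    using assms unfolding trunc_definable_def by (intro term_function_neg) blast
  then show "term_function I (\<lambda>x. trunc_unit (- g x + of_int d))"
    by (rule term_function_cong) (auto simp: trunc_unit_def min_def max_def)
qed

text \<open>With \<open>r = g x + d\<close>, the truncation of \<open>r + x i\<close> is the
  conjunction of the truncated sum of \<open>trunc_unit r\<close> and \<open>x i\<close> with
  \<open>trunc_unit (r + 1)\<close>. For \<open>r \<ge> 0\<close> the second factor is 1; for
  \<open>r \<le> 0\<close> the sum is just \<open>x i\<close>, and the second factor subtracts the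
  deficit \<open>- r\<close>, up to 1.\<close>

lemma trunc_definable_add_coordinate:
  assumes "trunc_definable I g" "i \<in> I"
  shows "trunc_definable I (\<lambda>x. g x + x i)"
  unfolding trunc_definable_def
proof
  fix d :: int
  have "term_function I (\<lambda>x. trunc_unit (g x + of_int d))"
    "term_function I (\<lambda>x. trunc_unit (g x + of_int (d + 1)))"
    using assms(1) unfolding trunc_definable_def by blast+
  from term_function_odot[OF
      term_function_oplus[OF this(1) term_function_coordinate[OF assms(2)]] this(2)]
  show "term_function I (\<lambda>x. trunc_unit (g x + x i + of_int d))"
  proof (rule term_function_cong)
    fix x assume "x \<in> cube I"
    then have x: "0 \<le> x i" "x i \<le> 1" using assms(2) by (auto simp: cube_def)
    have "max (min (trunc_unit r + x i) 1 + trunc_unit (r + 1) - 1) 0 = trunc_unit (r + x i)" for r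
    proof -
      consider "r \<le> -1" | "-1 \<le> r" "r \<le> 0" | "0 \<le> r" "r \<le> 1" | "1 \<le> r" by linarith
      then show ?thesis by cases (use x in \<open>simp_all add: trunc_unit_def min_def max_def\<close>)
    qed
    then show "max (min (trunc_unit (g x + of_int d) + x i) 1 +
        trunc_unit (g x + of_int (d + 1)) - 1) 0 = trunc_unit (g x + x i + of_int d)"
      by (metis add.commute add.left_commute of_int_add of_int_1)
  qed
qed

lemma trunc_definable_diff_coordinate:
  assumes "trunc_definable I g" "i \<in> I"
  shows "trunc_definable I (\<lambda>x. g x - x i)"
  using trunc_definable_uminus[OF
      trunc_definable_add_coordinate[OF trunc_definable_uminus[OF assms(1)] assms(2)]]
  by simp

lemma trunc_definable_add_multiple:
  assumes "trunc_definable I g" "i \<in> I"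
  shows "trunc_definable I (\<lambda>x. g x + of_int k * x i)"
proof (induction k rule: int_induct[where k = 0])
  case base
  then show ?case using assms(1) by simp
next
  case (step1 k)
  from trunc_definable_add_coordinate[OF step1(2) assms(2)]
  show ?case by (simp add: algebra_simps)
next
  case (step2 k)
  from trunc_definable_diff_coordinate[OF step2(2) assms(2)]
  show ?case by (simp add: algebra_simps)
qed

lemma trunc_definable_sum:
  assumes "finite K" "K \<subseteq> I"
  shows "trunc_definable I (\<lambda>x. \<Sum>i\<in>K. of_int (c i) * x i)"
  using assms
proof (induction K)
  case (insert i K)
  then show ?case
    using trunc_definable_add_multiple[of I "\<lambda>x. \<Sum>i\<in>K. of_int (c i) * x i" i "c i"]
    by (simp add: add.commute)
qed (simp add: trunc_definable_0)

text \<open>The constant term is absorbed as one of the integer translates in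
  \<open>trunc_definable\<close>.\<close>

lemma term_function_trunc_int_affine:
  assumes "finite I" "int_affine I g"
  shows "term_function I (\<lambda>x. trunc_unit (g x))"
proof -
  obtain c d where g: "\<forall>x\<in>I \<rightarrow>\<^sub>E UNIV. g x = (\<Sum>i\<in>I. of_int (c i) * x i) + of_int d"
    using assms(2) unfolding int_affine_def by blast
  have "term_function I (\<lambda>x. trunc_unit ((\<Sum>i\<in>I. of_int (c i) * x i) + of_int d))"
    using trunc_definable_sum[OF assms(1) order.refl] unfolding trunc_definable_def by blast
  then show ?thesis
    by (rule term_function_cong) (use g in \<open>auto simp: cube_def PiE_iff\<close>)
qed

section \<open>Continuous piecewise affine functions\<close>

text \<open>A piece that misses \<open>f\<close> at \<open>t0\<close> misses it throughout a
  neighbourhood, by continuity. Excluding the finitely many such pieces at once, any piece active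
  near \<open>t0\<close> is active at \<open>t0\<close> too.\<close>

lemma common_piece_nearby:
  fixes f :: "real \<Rightarrow> real" and l :: "'k \<Rightarrow> real \<Rightarrow> real"
  assumes "finite K" "continuous_on S f" "\<And>k. k \<in> K \<Longrightarrow> continuous_on S (l k)"
    and pieces: "\<And>t. t \<in> S \<Longrightarrow> \<exists>k\<in>K. f t = l k t" and "t0 \<in> S"
  obtains \<delta> where "\<delta> > 0"
    "\<And>t. t \<in> S \<Longrightarrow> dist t t0 < \<delta> \<Longrightarrow> \<exists>k\<in>K. f t = l k t \<and> f t0 = l k t0"
proof -
  have "\<forall>\<^sub>F t in at t0 within S. f t \<noteq> l k t" if k: "k \<in> K" "f t0 \<noteq> l k t0" for k
  proof -
    have "(f \<longlongrightarrow> f t0) (at t0 within S)" "(l k \<longlongrightarrow> l k t0) (at t0 within S)"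
      using assms(2,3,5) k(1) by (auto simp: continuous_on_def)
    from tendsto_imp_eventually_ne[OF tendsto_diff[OF this], of 0] k(2)
    show ?thesis by (auto elim: eventually_mono)
  qed
  then have "\<forall>\<^sub>F t in at t0 within S. \<forall>k\<in>{k \<in> K. f t0 \<noteq> l k t0}. f t \<noteq> l k t"
    using assms(1) by (intro eventually_ball_finite) auto
  then obtain \<delta> where \<delta>: "\<delta> > 0"
    "\<And>t. t \<in> S \<Longrightarrow> t \<noteq> t0 \<Longrightarrow> dist t t0 < \<delta> \<Longrightarrow> \<forall>k\<in>{k \<in> K. f t0 \<noteq> l k t0}. f t \<noteq> l k t"
    unfolding eventually_at by auto
  have "\<exists>k\<in>K. f t = l k t \<and> f t0 = l k t0" if "t \<in> S" "dist t t0 < \<delta>" for t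
    using \<delta>(2)[of t] pieces[of t] that by (cases "t = t0") auto
  with \<delta>(1) show ?thesis by (rule that)
qed

text \<open>The piece is found at a point where the graph of \<open>f\<close> meets its chord and does not rise
  relative to the chord: just after the last zero of the difference \<open>h\<close> before a point where
  \<open>h\<close> is negative or, if there is no such point, at the right end.\<close>

lemma piece_crossing_chord:
  fixes f :: "real \<Rightarrow> real" and a b :: "'k \<Rightarrow> real"
  assumes fin: "finite K" and cont: "continuous_on {0..1} f"
    and pieces: "\<And>t. t \<in> {0..1} \<Longrightarrow> \<exists>k\<in>K. f t = a k + b k * t"
  shows "\<exists>k\<in>K. f 0 \<le> a k \<and> a k + b k \<le> f 1"
proof -
  define c where "c = f 1 - f 0"
  define h where "h t = f t - (f 0 + c * t)" for t
  have h01: "h 0 = 0" "h 1 = 0"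
    by (simp_all add: h_def c_def)
  have cont_h: "continuous_on {0..1} h"
    unfolding h_def by (intro continuous_intros cont)
  \<comment> \<open>Piece \<open>k\<close> is no steeper than the chord and meets it at
    \<open>w\<close>, so it is not below the chord at 0 and not above it at 1.\<close>
  have crossing: ?thesis
    if uv: "0 \<le> u" "u < v" "v \<le> 1" "h v \<le> h u" and w: "w \<in> {u, v}" "h w = 0"
      and k: "k \<in> K" "f u = a k + b k * u" "f v = a k + b k * v" for u v w k
  proof -
    have "(b k - c) * (v - u) = h v - h u"
      by (simp add: h_def k algebra_simps)
    with uv have "b k \<le> c"
      by (smt (verit) mult_pos_pos)
    have ak: "a k = f 0 + (c - b k) * w"
      using w k by (auto simp: h_def algebra_simps)
    have "0 \<le> w" "w \<le> 1" using w(1) uv by auto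
    then have "0 \<le> (c - b k) * w" "(c - b k) * w \<le> c - b k"
      using \<open>b k \<le> c\<close> by (simp_all add: mult_left_le)
    then have "f 0 \<le> a k \<and> a k + b k \<le> f 1"
      using ak by (auto simp: c_def)
    with k(1) show ?thesis by blast
  qed
  have pieces_cont: "continuous_on {0..1} (\<lambda>t. a k + b k * t)" for k
    by (intro continuous_intros)
  have nearby: "\<exists>\<delta>>0. \<forall>t\<in>{0..1}. dist t t0 < \<delta> \<longrightarrow>
      (\<exists>k\<in>K. f t = a k + b k * t \<and> f t0 = a k + b k * t0)" if "t0 \<in> {0..1}" for t0
    using common_piece_nearby[OF fin cont pieces_cont pieces that] by metis
  show ?thesis
  proof (cases "\<forall>t\<in>{0..1}. 0 \<le> h t")
    case True
    obtain \<delta> where \<delta>: "\<delta> > 0" "\<forall>t\<in>{0..1}. dist t 1 < \<delta> \<longrightarrow>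
      (\<exists>k\<in>K. f t = a k + b k * t \<and> f 1 = a k + b k * 1)"
      using nearby[of 1] by auto
    \<comment> \<open>Just left of 1, but still in the interval: from
      \<open>h t \<ge> 0 = h 1\<close> the difference does not rise towards its zero at 1.\<close>
    define t where "t = max 0 (1 - \<delta> / 2)"
    have t: "0 \<le> t" "t < 1" "dist t 1 < \<delta>"
      using \<delta>(1) by (auto simp: t_def dist_real_def)
    then obtain k where "k \<in> K" "f t = a k + b k * t" "f 1 = a k + b k * 1"
      using \<delta>(2) by (meson atLeastAtMost_iff less_imp_le)
    then show ?thesis
      using True t h01 by (intro crossing[of t 1 1 k]) auto
  next
    case False
    then obtain v where v: "v \<in> {0..1}" "h v < 0" by force
    \<comment> \<open>By compactness \<open>Z\<close> has a greatest element \<open>t0\<close>,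
      beyond which \<open>h\<close> is negative up to \<open>v\<close>.\<close>
    define Z where "Z = {0..v} \<inter> h -` {0..}"
    have "continuous_on {0..v} h"
      using cont_h v by (auto intro: continuous_on_subset)
    then have "closed Z"
      unfolding Z_def by (intro continuous_closed_preimage) auto
    then have "compact ({0..v} \<inter> Z)" by (intro compact_Int_closed compact_Icc)
    also have "{0..v} \<inter> Z = Z" by (auto simp: Z_def)
    finally have "compact Z" .
    moreover have "0 \<in> Z" using v h01 by (simp add: Z_def)
    ultimately obtain t0 where t0: "t0 \<in> Z" and sup: "\<And>t. t \<in> Z \<Longrightarrow> t \<le> t0"
      using compact_attains_sup[of Z] by blast
    then have "t0 \<noteq> v" using v(2) by (auto simp: Z_def)
    with t0 have t0v: "0 \<le> t0" "t0 < v" "0 \<le> h t0" by (auto simp: Z_def)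
    \<comment> \<open>As \<open>h t0 \<ge> 0 > h v\<close>, there is a zero of \<open>h\<close>
      between \<open>t0\<close> and \<open>v\<close>; it belongs to \<open>Z\<close>, so it can only
      be \<open>t0\<close>.\<close>
    have "continuous_on {t0..v} h"
      using cont_h v t0v by (auto intro: continuous_on_subset)
    then obtain z where z: "t0 \<le> z" "z \<le> v" "h z = 0"
      using IVT2'[of h v 0 t0] t0v v by auto
    then have "z \<in> Z" using t0v by (simp add: Z_def)
    with sup z have ht0: "h t0 = 0" by force
    obtain \<delta> where \<delta>: "\<delta> > 0" "\<forall>t\<in>{0..1}. dist t t0 < \<delta> \<longrightarrow>
      (\<exists>k\<in>K. f t = a k + b k * t \<and> f t0 = a k + b k * t0)"
      using nearby[of t0] t0v v by auto
    \<comment> \<open>Close enough to share a piece with \<open>t0\<close>, yet beyond it and hence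
      outside \<open>Z\<close>, so \<open>h\<close> drops from 0 to a negative value.\<close>
    define t where "t = min v (t0 + \<delta> / 2)"
    have t: "t0 < t" "t \<le> v" "dist t t0 < \<delta>"
      using \<delta>(1) t0v by (auto simp: t_def dist_real_def)
    then have "t \<notin> Z" using sup[of t] by auto
    then have "h t < 0" using t t0v by (auto simp: Z_def)
    have "t \<in> {0..1}" using t t0v v by auto
    with \<delta>(2) t obtain k where "k \<in> K" "f t = a k + b k * t" "f t0 = a k + b k * t0"
      by blast
    then show ?thesis
      using t t0v v ht0 \<open>h t < 0\<close> by (intro crossing[of t0 t t0 k]) auto
  qed
qed

text \<open>Along the segment from \<open>a\<close> to \<open>b\<close> each piece \<open>g\<close>
  is affine with intercept \<open>g a\<close> and slope \<open>g b - g a\<close>, which reduces the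
  claim to one variable.\<close>

lemma piece_between_points:
  assumes f: "continuous_map (product_topology (\<lambda>_. top_of_set {0..1}) I) (top_of_set {0..1}) f"
    and F: "finite F" "\<forall>g\<in>F. int_affine I g" "\<forall>x\<in>cube I. \<exists>g\<in>F. f x = g x"
    and ab: "a \<in> cube I" "b \<in> cube I"
  shows "\<exists>g\<in>F. f a \<le> g a \<and> g b \<le> f b"
proof -
  define \<gamma> where "\<gamma> t = (\<lambda>i\<in>I. a i + t * (b i - a i))" for t :: real
  have ends: "\<gamma> 0 = a" "\<gamma> 1 = b"
    using ab by (auto simp: \<gamma>_def cube_def PiE_def extensional_def fun_eq_iff)
  have unit: "a i + t * (b i - a i) \<in> {0..1}" if "i \<in> I" "t \<in> {0..1}" for i t
  proof -
    have "a i \<in> {0..1}" "b i \<in> {0..1}" using ab that by (auto simp: cube_def)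
    then have "0 \<le> (1 - t) * a i + t * b i" "(1 - t) * a i + t * b i \<le> 1"
      using that by (auto intro: convex_bound_le)
    then show ?thesis by (simp add: algebra_simps)
  qed
  then have \<gamma>_cube: "\<gamma> t \<in> cube I" if "t \<in> {0..1}" for t
    using that by (simp add: \<gamma>_def cube_def)
  have "continuous_map (top_of_set {0..1}) (product_topology (\<lambda>_. top_of_set {0..1}) I) \<gamma>"
    unfolding continuous_map_componentwise
  proof (intro conjI ballI)
    fix i assume i: "i \<in> I"
    have "continuous_on {0..1} (\<lambda>t. a i + t * (b i - a i))"
      by (intro continuous_intros)
    then show "continuous_map (top_of_set {0..1}) (top_of_set {0..1}) (\<lambda>t. \<gamma> t i)"
      using i unit[OF i] by (simp add: \<gamma>_def continuous_map_in_subtopology Pi_iff)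
  qed (auto simp: \<gamma>_def)
  from continuous_map_compose[OF this f] have cont: "continuous_on {0..1} (\<lambda>t. f (\<gamma> t))"
    by (simp add: continuous_map_in_subtopology o_def)
  have affine: "g (\<gamma> t) = g a + (g b - g a) * t" if "g \<in> F" "t \<in> {0..1}" for g t
  proof -
    obtain c d where g: "\<forall>x\<in>I \<rightarrow>\<^sub>E UNIV. g x = (\<Sum>i\<in>I. of_int (c i) * x i) + of_int d"
      using F(2) \<open>g \<in> F\<close> unfolding int_affine_def by blast
    have "cube I \<subseteq> I \<rightarrow>\<^sub>E UNIV" by (auto simp: cube_def)
    with g have g': "g x = (\<Sum>i\<in>I. of_int (c i) * x i) + of_int d" if "x \<in> cube I" for x
      using that by blast
    have "(\<Sum>i\<in>I. of_int (c i) * \<gamma> t i) = (\<Sum>i\<in>I. of_int (c i) * (a i + t * (b i - a i)))"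
      by (simp add: \<gamma>_def)
    also have "\<dots> = (\<Sum>i\<in>I. of_int (c i) * a i) +
        t * ((\<Sum>i\<in>I. of_int (c i) * b i) - (\<Sum>i\<in>I. of_int (c i) * a i))"
      by (simp add: sum_subtractf[symmetric] sum_distrib_left sum.distrib[symmetric] algebra_simps)
    finally show ?thesis
      using g'[OF \<gamma>_cube[OF that(2)]] g'[OF ab(1)] g'[OF ab(2)] by (simp add: algebra_simps)
  qed
  have "\<exists>g\<in>F. f (\<gamma> t) = g a + (g b - g a) * t" if "t \<in> {0..1}" for t
    using F(3) \<gamma>_cube[OF that] affine that by metis
  from piece_crossing_chord[OF F(1) cont this] ends show ?thesis
    by auto
qed

section \<open>McNaughton's theorem: the maximum of minima of truncated pieces\<close>

theorem mcnaughton: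
  fixes I :: "'i set"
  assumes "finite_pl_int I f"
  shows "term_function I f"
proof -
  obtain F where cont: "continuous_map (product_topology (\<lambda>_. top_of_set {0..1}) I)
        (top_of_set {0..1}) f"
    and F: "finite F" "\<forall>g\<in>F. int_affine I g" "\<forall>x\<in>cube I. \<exists>g\<in>F. f x = g x"
    and I: "finite I"
    using assms unfolding finite_pl_int_def by blast
  define above where "above a = {g \<in> F. f a \<le> g a}" for a
  define m where "m S x = Min (insert 1 ((\<lambda>g. trunc_unit (g x)) ` S))"
    for S :: "(('i \<Rightarrow> real) \<Rightarrow> real) set" and x
  have sub: "above ` cube I \<subseteq> Pow F" by (auto simp: above_def)
  then have fin: "finite (above ` cube I)" using F(1) by (simp add: finite_subset)
  have "term_function I (m S)" if "S \<in> above ` cube I" for S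
  proof -
    have "S \<subseteq> F" using that sub by blast
    then show ?thesis
      unfolding m_def using F(1,2) finite_subset[of S F]
      by (intro term_function_Min term_function_trunc_int_affine I) auto
  qed
  with fin have "term_function I (\<lambda>x. Max (insert 0 ((\<lambda>S. m S x) ` above ` cube I)))"
    by (rule term_function_Max)
  then show ?thesis
  proof (rule term_function_cong)
    fix x assume x: "x \<in> cube I"
    have fx: "f x \<in> {0..1}" using finite_pl_int_range[OF assms x] .
    show "Max (insert 0 ((\<lambda>S. m S x) ` above ` cube I)) = f x"
    proof (rule Max_eqI)
      fix y assume "y \<in> insert 0 ((\<lambda>S. m S x) ` above ` cube I)"
      then consider "y = 0" | a where "a \<in> cube I" "y = m (above a) x" by blast
      then show "y \<le> f x"
      proof cases
        case 2
        \<comment> \<open>This piece takes part in the minimum for \<open>a\<close> and lies below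
          \<open>f\<close> at \<open>x\<close>, so the minimum cannot exceed
          \<open>f x\<close>.\<close>
        obtain g where g: "g \<in> F" "f a \<le> g a" "g x \<le> f x"
          using piece_between_points[OF cont F \<open>a \<in> cube I\<close> x] by blast
        then have "m (above a) x \<le> trunc_unit (g x)"
          unfolding m_def by (intro Min_le) (use F(1) in \<open>auto simp: above_def\<close>)
        also have "\<dots> \<le> f x"
          using trunc_unit_mono[OF g(3)] trunc_unit_id[OF fx] by simp
        finally show ?thesis using 2 by simp
      qed (use fx in auto)
    next
      \<comment> \<open>The maximum is attained for \<open>a = x\<close>: all pieces in
        \<open>above x\<close> are at least \<open>f x\<close> there, and the active one equals
        it.\<close>
      have "m (above x) x = f x"
        unfolding m_def
      proof (rule Min_eqI)
        show "finite (insert 1 ((\<lambda>g. trunc_unit (g x)) ` above x))"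
          using F(1) by (simp add: above_def)
        show "f x \<le> y" if "y \<in> insert 1 ((\<lambda>g. trunc_unit (g x)) ` above x)" for y
          using that fx trunc_unit_mono[of "f x"] trunc_unit_id[OF fx] by (auto simp: above_def)
        obtain g where "g \<in> F" "f x = g x" using F(3) x by blast
        then show "f x \<in> insert 1 ((\<lambda>g. trunc_unit (g x)) ` above x)"
          using trunc_unit_id[OF fx] by (auto simp: above_def intro!: rev_image_eqI[of g])
      qed
      with x show "f x \<in> insert 0 ((\<lambda>S. m S x) ` above ` cube I)" by force
    qed (use fin in simp)
  qed
qed

section \<open>Definable maps and \<open>\<int>\<close>-maps\<close>

text \<open>McNaughton's theorem for arbitrary \<open>I\<close>: the finite support of a piecewise
  linear map corresponds to the finite set of variables of a term.\<close>

lemma pl_int_iff_mv_eval: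
  "pl_int I f \<longleftrightarrow> (\<exists>t\<in>mv_terms I. \<forall>x\<in>cube I. f x = mv_eval std_mv x t)"
proof
  assume "pl_int I f"
  then obtain I' f' where I': "I' \<subseteq> I" and "finite_pl_int I' f'"
    and f: "\<forall>x\<in>cube I. f x = f' (restrict x I')"
    unfolding pl_int_def by blast
  then obtain t where t: "t \<in> mv_terms I'" "\<forall>x\<in>cube I'. mv_eval std_mv x t = f' x"
    using mcnaughton unfolding term_function_def by blast
  then have "f x = mv_eval std_mv x t" if "x \<in> cube I" for x
    using f that restrict_cube[OF that I'] mv_eval_restrict[OF t(1)] by metis
  with t(1) I' show "\<exists>t\<in>mv_terms I. \<forall>x\<in>cube I. f x = mv_eval std_mv x t"
    using mv_terms_mono by blast
next
  assume "\<exists>t\<in>mv_terms I. \<forall>x\<in>cube I. f x = mv_eval std_mv x t"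
  then obtain t where t: "t \<in> mv_terms I" "\<forall>x\<in>cube I. f x = mv_eval std_mv x t"
    by blast
  define I' where "I' = set_mv_term t"
  have "finite (set_mv_term t)" by (induction t) auto
  then have I': "finite I'" "I' \<subseteq> I" "t \<in> mv_terms I'"
    using t(1) by (auto simp: I'_def mv_terms_def)
  show "pl_int I f"
    unfolding pl_int_def
  proof (intro exI conjI ballI)
    show "finite_pl_int I' (\<lambda>x. mv_eval std_mv x t)"
      using I' by (intro finite_pl_int_mv_eval)
    show "f x = mv_eval std_mv (restrict x I') t" if "x \<in> cube I" for x
      using t(2) that mv_eval_restrict[OF I'(3)] by metis
  qed (use I' in auto)
qed

lemma pl_int_range: "pl_int I f \<Longrightarrow> x \<in> cube I \<Longrightarrow> f x \<in> {0..1}"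
  using mv_eval_range unfolding pl_int_iff_mv_eval by metis

text \<open>On the level of terms, composing with a projection leaves the term unchanged and only
  enlarges the set of allowed variables.\<close>

lemma pl_int_restrict:
  assumes "pl_int I' f" "I' \<subseteq> I"
  shows "pl_int I (\<lambda>x. f (restrict x I'))"
proof -
  obtain t where t: "t \<in> mv_terms I'" "\<forall>x\<in>cube I'. f x = mv_eval std_mv x t"
    using assms(1) unfolding pl_int_iff_mv_eval by blast
  then have "f (restrict x I') = mv_eval std_mv x t" if "x \<in> cube I" for x
    using restrict_cube[OF that assms(2)] by (simp add: mv_eval_restrict)
  with t(1) show ?thesis
    using mv_terms_mono[OF assms(2)] unfolding pl_int_iff_mv_eval by blast
qed

text \<open>Recasts the function on the small cube as \<open>pl_int\<close>, the form in which a
  \<open>Z_map\<close> between finite cubes uses it.\<close>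

lemma pl_int_finite_support:
  assumes "pl_int I f"
  obtains I' f' where "finite I'" "I' \<subseteq> I" "pl_int I' f'"
    "\<And>x. x \<in> cube I \<Longrightarrow> f x = f' (restrict x I')"
proof -
  obtain I' f' where *: "finite I'" "I' \<subseteq> I" "finite_pl_int I' f'"
    "\<forall>x\<in>cube I. f x = f' (restrict x I')"
    using assms unfolding pl_int_def by blast
  have "restrict x I' = x" if "x \<in> cube I'" for x
    using that by (auto simp: cube_def PiE_def extensional_restrict)
  with *(1,3) have "pl_int I' f'"
    unfolding pl_int_def by (intro exI[of _ I'] exI[of _ f']) simp
  with * show ?thesis using that by blast
qed

text \<open>Both notions decouple into conditions on single coordinates, which agree because term
  evaluations and piecewise linear maps coincide. Unless \<open>P\<close> lies in the cube, both
  sides are false.\<close>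

lemma definable_map_iff_Z_map: "definable_map I J P Q \<eta> \<longleftrightarrow> Z_map I J P Q \<eta>"
proof (cases "P \<subseteq> cube I")
  case P: True
  have bar: "mv_bar I p (mv_eq I `` {t}) = mv_eval std_mv p t" if "p \<in> P" "t \<in> mv_terms I" for p t
    using mv_bar_eq_mv_eval P that by blast
  have coord: "(\<exists>X\<in>carrier (free_mv I). \<forall>p\<in>P. \<eta> p j = mv_bar I p X) \<longleftrightarrow>
      (\<exists>\<xi>. pl_int I \<xi> \<and> (\<forall>p\<in>P. \<eta> p j = \<xi> p))" (is "?X \<longleftrightarrow> ?\<xi>") for j
  proof
    assume ?X
    then obtain t where "t \<in> mv_terms I" "\<forall>p\<in>P. \<eta> p j = mv_eval std_mv p t"
      using bar by (metis free_mv_cases)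
    then show ?\<xi>
      by (intro exI[of _ "\<lambda>p. mv_eval std_mv p t"]) (auto simp: pl_int_iff_mv_eval)
  next
    assume ?\<xi>
    then obtain t where "t \<in> mv_terms I" "\<forall>p\<in>P. \<eta> p j = mv_eval std_mv p t"
      unfolding pl_int_iff_mv_eval using P by (metis subsetD)
    then show ?X
      using bar by (intro bexI[of _ "mv_eq I `` {t}"]) auto
  qed
  \<comment> \<open>Choice assembles the elements found for the single coordinates into a
    family.\<close>
  have "(\<exists>t\<in>J \<rightarrow> carrier (free_mv I). \<forall>p\<in>P. \<forall>j\<in>J. \<eta> p j = mv_bar I p (t j)) \<longleftrightarrow>
      (\<forall>j\<in>J. \<exists>X\<in>carrier (free_mv I). \<forall>p\<in>P. \<eta> p j = mv_bar I p X)" (is "?L \<longleftrightarrow> ?R")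
  proof
    assume ?R
    then obtain t where "\<forall>j\<in>J. t j \<in> carrier (free_mv I) \<and> (\<forall>p\<in>P. \<eta> p j = mv_bar I p (t j))"
      by metis
    then show ?L by (intro bexI[of _ t]) auto
  qed blast
  then show ?thesis
    unfolding definable_map_def Z_map_def coord by simp
qed (simp add: definable_map_def Z_map_def)

lemma Z_map_factorization:
  assumes "Z_map I J P Q \<eta>" "J' \<subseteq> J" "finite J'"
  obtains I' \<xi> where "I' \<subseteq> I" "finite I'" "Z_map I' J' (cube I') (cube J') \<xi>"
    "\<And>p. p \<in> P \<Longrightarrow> restrict (\<eta> p) J' = \<xi> (restrict p I')"
proof -
  have P: "P \<subseteq> cube I" using assms(1) by (simp add: Z_map_def)
  have "\<exists>K f. finite K \<and> K \<subseteq> I \<and> pl_int K f \<and> (\<forall>p\<in>P. \<eta> p j = f (restrict p K))"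
    if "j \<in> J'" for j
  proof -
    have "j \<in> J" using that assms(2) by blast
    with assms(1) obtain g where g: "pl_int I g" "\<forall>p\<in>P. \<eta> p j = g p"
      unfolding Z_map_def by metis
    from g(1) show ?thesis
    proof (rule pl_int_finite_support)
      fix K f assume K: "finite K" "K \<subseteq> I" "pl_int K f"
        and f: "\<And>x. x \<in> cube I \<Longrightarrow> g x = f (restrict x K)"
      have "\<forall>p\<in>P. \<eta> p j = f (restrict p K)"
        using P g(2) f by (simp add: subset_iff)
      with K show ?thesis by blast
    qed
  qed
  then obtain K f where Kf: "\<And>j. j \<in> J' \<Longrightarrow> finite (K j) \<and> K j \<subseteq> I \<and> pl_int (K j) (f j) \<and>
      (\<forall>p\<in>P. \<eta> p j = f j (restrict p (K j)))"
    by metis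
  \<comment> \<open>One finite set of variables for all coordinates: a finite union of finite
    supports.\<close>
  define I' where "I' = (\<Union>j\<in>J'. K j)"
  define \<xi> where "\<xi> x = (\<lambda>j\<in>J'. f j (restrict x (K j)))" for x
  have pl: "pl_int I' (\<lambda>x. f j (restrict x (K j)))" if "j \<in> J'" for j
    using Kf that by (intro pl_int_restrict) (auto simp: I'_def)
  have "\<xi> x \<in> cube J'" if "x \<in> cube I'" for x
    using pl_int_range[OF pl that] by (simp add: \<xi>_def cube_def)
  moreover have "\<exists>\<zeta>. pl_int I' \<zeta> \<and> (\<forall>p\<in>cube I'. \<xi> p j = \<zeta> p)" if "j \<in> J'" for j
    using pl[OF that] that by (intro exI[of _ "\<lambda>x. f j (restrict x (K j))"]) (simp add: \<xi>_def)
  ultimately have "Z_map I' J' (cube I') (cube J') \<xi>"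
    by (auto simp: Z_map_def)
  moreover have "restrict (\<eta> p) J' = \<xi> (restrict p I')" if "p \<in> P" for p
    unfolding \<xi>_def
  proof (rule restrict_ext)
    fix j assume j: "j \<in> J'"
    then have "I' \<inter> K j = K j" by (auto simp: I'_def)
    then show "\<eta> p j = f j (restrict (restrict p I') (K j))"
      using Kf[OF j] that by simp
  qed
  ultimately show ?thesis
    using Kf assms(3) by (intro that[of I' \<xi>]) (auto simp: I'_def)
qed

theorem theorem3p4:
  fixes I :: "'i set" and J :: "'j set"
    and P :: "('i \<Rightarrow> real) set" and Q :: "('j \<Rightarrow> real) set"
    and \<eta> :: "('i \<Rightarrow> real) \<Rightarrow> ('j \<Rightarrow> real)"
  assumes "P \<subseteq> cube I" and "Q \<subseteq> cube J" and "\<eta> \<in> P \<rightarrow> Q"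
  shows "(definable_map I J P Q \<eta> \<longleftrightarrow> Z_map I J P Q \<eta>) \<and>
    (Z_map I J P Q \<eta> \<longleftrightarrow>
      (\<forall>J'. J' \<subseteq> J \<and> finite J' \<longrightarrow>
        (\<exists>I' \<xi>. I' \<subseteq> I \<and> finite I' \<and> Z_map I' J' (cube I') (cube J') \<xi> \<and>
          (\<forall>p\<in>P. restrict (\<eta> p) J' = \<xi> (restrict p I')))))"
proof (intro conjI iffI)
  assume Z: "Z_map I J P Q \<eta>"
  show "\<forall>J'. J' \<subseteq> J \<and> finite J' \<longrightarrow>
      (\<exists>I' \<xi>. I' \<subseteq> I \<and> finite I' \<and> Z_map I' J' (cube I') (cube J') \<xi> \<and>
        (\<forall>p\<in>P. restrict (\<eta> p) J' = \<xi> (restrict p I')))"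
  proof (intro allI impI, elim conjE)
    fix J' assume J': "J' \<subseteq> J" "finite J'"
    show "\<exists>I' \<xi>. I' \<subseteq> I \<and> finite I' \<and> Z_map I' J' (cube I') (cube J') \<xi> \<and>
        (\<forall>p\<in>P. restrict (\<eta> p) J' = \<xi> (restrict p I'))"
      by (rule Z_map_factorization[OF Z J']) blast
  qed
next
  assume fac: "\<forall>J'. J' \<subseteq> J \<and> finite J' \<longrightarrow>
      (\<exists>I' \<xi>. I' \<subseteq> I \<and> finite I' \<and> Z_map I' J' (cube I') (cube J') \<xi> \<and>
        (\<forall>p\<in>P. restrict (\<eta> p) J' = \<xi> (restrict p I')))"
  \<comment> \<open>The \<open>Z_map\<close> condition concerns one coordinate at a time, so
    factorizations for singletons \<open>J' = {j}\<close> suffice.\<close>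
  have "\<exists>\<xi>. pl_int I \<xi> \<and> (\<forall>p\<in>P. \<eta> p j = \<xi> p)" if j: "j \<in> J" for j
  proof -
    have "{j} \<subseteq> J \<and> finite {j}" using j by simp
    from fac[rule_format, OF this] obtain I' \<xi> where I': "I' \<subseteq> I"
      and "Z_map I' {j} (cube I') (cube {j}) \<xi>"
      and \<xi>: "\<forall>p\<in>P. restrict (\<eta> p) {j} = \<xi> (restrict p I')"
      by blast
    then obtain f where f: "pl_int I' f" "\<forall>x\<in>cube I'. \<xi> x j = f x"
      by (auto simp: Z_map_def)
    have "\<eta> p j = f (restrict p I')" if "p \<in> P" for p
    proof -
      have "\<eta> p j = restrict (\<eta> p) {j} j" by simp
      also have "\<dots> = \<xi> (restrict p I') j" using \<xi> that by simp
      also have "\<dots> = f (restrict p I')"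
        using f(2) restrict_cube[OF _ I'] assms(1) that by blast
      finally show ?thesis .
    qed
    with pl_int_restrict[OF f(1) I'] show ?thesis by blast
  qed
  with assms show "Z_map I J P Q \<eta>" by (simp add: Z_map_def)
qed (simp_all add: definable_map_iff_Z_map)

end
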